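(* Let $\theta\in(0,1)$ be irrational with $\theta^2=1/m$ for some $m\in\mathbb{N}_+$. Let $\{a(n)\}_{n\ge1}$ be a sequence of positive numbers such that $a(n)/n$ is non-decreasing. Then for $\gamma_\theta$-almost every $x\in[0,\theta]$: if $\sum_{n=1}^\infty 1/a(n)<\infty$ then $\lim_{n\to\infty}S_{n,\theta}(x)/a(n)=0$, and if $\sum_{n=1}^\infty 1/a(n)=\infty$ then $\limsup_{n\to\infty}S_{n,\theta}(x)/a(n)=\infty$.
   Context: Let $m\in\mathbb{N}_+$ not be a perfect square and $\theta=1/\sqrt m\in(0,1)$. The map $T_\theta:[0,\theta]\to[0,\theta]$ is $T_\theta(x)=\frac1x-\theta\lfloor\frac{1}{\theta x}\rfloor$ for $x\in(0,\theta]$ and $T_\theta(0)=0$. The digits of $x$ are $\ell_n(x)=\lfloor \frac{1}{\theta T_\theta^{n-1}(x)}\rfloor$ for $n\ge1$ (with $T_\theta^0(x)=x$); they take values in $\{m,m+1,\dots\}$ and are defined for almost every $x$. The probability measure $\gamma_\theta$ on $[0,\theta]$ has density $\frac{1}{\log(1+\theta^2)}\cdot\frac{\theta}{1+\theta x}$ with respect to Lebesgue measure; it is $T_\theta$-invariant and ergodic. Define $S_{n,\theta}(x)=\sum_{k=1}^n\ell_k(x)$. *)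

theory Defs
  imports "HOL-Analysis.Analysis"
begin

definition T_theta :: "real \<Rightarrow> real \<Rightarrow> real" where
  "T_theta \<theta> x = (if x = 0 then 0 else 1 / x - \<theta> * of_int \<lfloor>1 / (\<theta> * x)\<rfloor>)"

definition digit_theta :: "real \<Rightarrow> nat \<Rightarrow> real \<Rightarrow> int" where
  "digit_theta \<theta> n x = \<lfloor>1 / (\<theta> * (T_theta \<theta> ^^ (n - 1)) x)\<rfloor>"

definition S_theta :: "real \<Rightarrow> nat \<Rightarrow> real \<Rightarrow> real" where
  "S_theta \<theta> n x = (\<Sum>k=1..n. real_of_int (digit_theta \<theta> k x))"

definition gamma_theta :: "real \<Rightarrow> real measure" where
  "gamma_theta \<theta> = density (restrict_space lborel {0..\<theta>})
      (\<lambda>x. ennreal (\<theta> / (ln (1 + \<theta>\<^sup>2) * (1 + \<theta> * x))))"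

end

theory Submission
  imports Defs "HOL-Real_Asymp.Real_Asymp"
begin

text \<open>
  Write \<open>a n = n * b n\<close> with \<open>b\<close> nondecreasing.

  If \<open>\<Sum> 1 / a n\<close> converges, let \<open>\<alpha>\<close> be an inverse of \<open>a\<close> for which \<open>\<alpha> x / x\<close> is
  nonincreasing. Then \<open>\<alpha>\<close> is subadditive, and the tail \<open>\<ell> > t\<close> of the first digit having measure
  \<open>O(1/t)\<close> makes \<open>\<alpha>(\<ell>)\<close> integrable. Digits at most \<open>M\<close> contribute at most \<open>\<alpha>(M n) = o(n)\<close> to
  \<open>\<alpha>(S\<^sub>n)\<close>; the others contribute at most a Birkhoff sum of a function of small integral, which the
  maximal ergodic inequality controls. So \<open>\<alpha>(S\<^sub>n) = o(n)\<close>, and this means \<open>S\<^sub>n = o(a n)\<close>.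

  If \<open>\<Sum> 1 / a n\<close> diverges, a single digit is enough: the transfer operators of the digit cylinders
  preserve the densities whose logarithm is Lipschitz with a fixed constant, so conditionally on the
  past each digit exceeds \<open>K * a n\<close> with probability at least a constant times \<open>1 / a n\<close>, and almost
  surely this happens infinitely often.
\<close>

section \<open>The map, its inverse branches and its invariant measure\<close>

locale theta_map =
  fixes \<theta> :: real and m :: nat
  assumes theta_pos: "0 < \<theta>" and theta_less_1: "\<theta> < 1" and theta_square: "\<theta>\<^sup>2 = 1 / real m"
begin

abbreviation T :: "real \<Rightarrow> real" where "T \<equiv> T_theta \<theta>"

definition digit :: "real \<Rightarrow> int" where "digit x = \<lfloor>1 / (\<theta> * x)\<rfloor>"

text \<open>The inverse branch of \<open>T\<close> with first digit \<open>m + i\<close>. Counting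
  from the least digit \<open>m\<close> makes every natural number \<open>i\<close> an admissible
  index.\<close>

definition branch :: "nat \<Rightarrow> real \<Rightarrow> real" where "branch i y = 1 / (real (m + i) * \<theta> + y)"

lemma m_pos: "0 < m"
  using theta_pos theta_square by (cases "m = 0") auto

text \<open>This form of the relation between \<theta> and \<open>m\<close> gives
  \<open>branch 0 0 = \<theta>\<close>: the cylinder of the least digit ends exactly at \<theta>, so
  every branch is full.\<close>

lemma m_theta: "real m * \<theta> = 1 / \<theta>"
  using theta_square theta_pos m_pos by (simp add: power2_eq_square field_simps)

lemma branch_shift_ge: "1 / \<theta> \<le> real (m + i) * \<theta>"
  using m_theta theta_pos by (simp add: algebra_simps)

lemma branch_denom_ge: "0 \<le> y \<Longrightarrow> 1 / \<theta> \<le> real (m + i) * \<theta> + y"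
  using branch_shift_ge[of i] by linarith

lemma branch_denom_pos: "0 \<le> y \<Longrightarrow> 0 < real (m + i) * \<theta> + y"
  using branch_denom_ge[of y i] theta_pos by (smt (verit) divide_pos_pos)

lemma branch_range: "0 \<le> y \<Longrightarrow> 0 < branch i y \<and> branch i y \<le> \<theta>"
  using branch_denom_ge[of y i] branch_denom_pos[of y i] theta_pos
  by (simp add: branch_def field_simps)

text \<open>The bound \<open>y < \<theta>\<close> is strict because the digit jumps to
  \<open>m + i + 1\<close> at \<open>y = \<theta>\<close>; later integrals discard this point as a
  null set.\<close>

lemma digit_branch:
  assumes "0 \<le> y" "y < \<theta>"
  shows "digit (branch i y) = int (m + i)"
proof -
  have "1 / (\<theta> * branch i y) = real (m + i) + y / \<theta>"
    using theta_pos branch_denom_pos[OF assms(1), of i] by (simp add: branch_def field_simps)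
  moreover have "0 \<le> y / \<theta>" "y / \<theta> < 1"
    using assms theta_pos by auto
  ultimately show ?thesis
    unfolding digit_def by (intro floor_unique) auto
qed

lemma T_eq_digit: "x \<noteq> 0 \<Longrightarrow> T x = 1 / x - \<theta> * digit x"
  by (simp add: T_theta_def digit_def)

lemma T_branch:
  assumes "0 \<le> y" "y < \<theta>"
  shows "T (branch i y) = y"
proof -
  have "T (branch i y) = 1 / branch i y - \<theta> * real (m + i)"
    using branch_range[OF assms(1), of i] by (simp add: T_eq_digit digit_branch[OF assms])
  thus ?thesis by (simp add: branch_def)
qed

lemma T_range: "0 \<le> T x \<and> T x < \<theta>"
proof (cases "x = 0")
  case False
  have "real_of_int \<lfloor>1 / (\<theta> * x)\<rfloor> \<le> 1 / (\<theta> * x)" "1 / (\<theta> * x) < real_of_int \<lfloor>1 / (\<theta> * x)\<rfloor> + 1"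
    by linarith+
  hence "\<theta> * real_of_int \<lfloor>1 / (\<theta> * x)\<rfloor> \<le> \<theta> * (1 / (\<theta> * x))"
    "\<theta> * (1 / (\<theta> * x)) < \<theta> * (real_of_int \<lfloor>1 / (\<theta> * x)\<rfloor> + 1)"
    using theta_pos by (simp_all only: mult_left_mono mult_strict_left_mono less_imp_le)
  moreover have "\<theta> * (1 / (\<theta> * x)) = 1 / x"
    using theta_pos by simp
  ultimately show ?thesis
    using False theta_pos by (simp add: T_theta_def algebra_simps)
qed (simp add: T_theta_def theta_pos)

lemma T_funpow_range: "0 \<le> x \<Longrightarrow> x \<le> \<theta> \<Longrightarrow> 0 \<le> (T ^^ n) x \<and> (T ^^ n) x \<le> \<theta>"
  by (cases n) (use T_range less_imp_le in auto)

lemma digit_nonneg: "0 \<le> x \<Longrightarrow> 0 \<le> digit x"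
  using theta_pos by (simp add: digit_def)

lemma T_measurable [measurable]: "T \<in> borel_measurable borel"
  unfolding T_theta_def by measurable

lemma T_funpow_measurable [measurable]: "(T ^^ n) \<in> borel_measurable borel"
  by (induction n) auto

lemma digit_measurable [measurable]: "digit \<in> measurable borel (count_space UNIV)"
  unfolding digit_def by measurable

lemma branch_measurable [measurable]: "branch i \<in> borel_measurable borel"
  unfolding branch_def by measurable

section \<open>Change of variables along the inverse branches\<close>

lemma nn_integral_branch:
  assumes [measurable]: "F \<in> borel_measurable borel"
  shows "(\<integral>\<^sup>+x\<in>{1 / (real (m + Suc i) * \<theta>)<..1 / (real (m + i) * \<theta>)}. F x \<partial>lborel)
       = (\<integral>\<^sup>+y\<in>{0..\<theta>}. F (branch i y) * ennreal ((branch i y)\<^sup>2) \<partial>lborel)"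
proof -
  define c where "c = real (m + i) * \<theta>"
  have c: "0 < c" using branch_denom_pos[of 0 i] by (simp add: c_def)
  \<comment> \<open>\<open>branch i\<close> is decreasing while the substitution rule asks for a
    nonnegative derivative. So the substitution uses \<open>branch i (- y)\<close> on
    \<open>{-\<theta>..0}\<close> and is reflected afterwards.\<close>
  define g where "g y = 1 / (c - y)" for y
  have "(\<integral>\<^sup>+x\<in>{1 / (real (m + Suc i) * \<theta>)<..1 / (real (m + i) * \<theta>)}. F x \<partial>lborel)
      = (\<integral>\<^sup>+x. F x * indicator {g (-\<theta>)..g 0} x \<partial>lborel)"
  proof (rule nn_integral_cong_AE)
    show "AE x in lborel. F x * indicator {1 / (real (m + Suc i) * \<theta>)<..1 / (real (m + i) * \<theta>)} x =
           F x * indicator {g (- \<theta>)..g 0} x"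
      using AE_lborel_singleton[of "g (- \<theta>)"]
      by eventually_elim (auto simp: g_def c_def indicator_def algebra_simps)
  qed
  also have "\<dots> = (\<integral>\<^sup>+x. F (g x) * ennreal (1 / (c - x)\<^sup>2) * indicator {-\<theta>..0} x \<partial>lborel)"
  proof (rule nn_integral_substitution_aux)
    show "(g has_real_derivative 1 / (c - x)\<^sup>2) (at x)" if "x \<in> {-\<theta>..0}" for x
      unfolding g_def using that c
      by (auto intro!: derivative_eq_intros simp: power2_eq_square)
    show "continuous_on {- \<theta>..0} (\<lambda>x. 1 / (c - x)\<^sup>2)"
      using c by (auto intro!: continuous_intros)
  qed (use theta_pos in auto)
  also have "\<dots> = (\<integral>\<^sup>+x. F (g (- x)) * ennreal (1 / (c + x)\<^sup>2) * indicator {-\<theta>..0} (- x) \<partial>lborel)"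
    by (subst nn_integral_real_affine[where c = "-1" and t = 0]) (auto simp: g_def)
  also have "\<dots> = (\<integral>\<^sup>+y\<in>{0..\<theta>}. F (branch i y) * ennreal ((branch i y)\<^sup>2) \<partial>lborel)"
    by (intro nn_integral_cong) (auto simp: g_def c_def branch_def indicator_def power_divide)
  finally show ?thesis .
qed

text \<open>The digit cylinders \<open>B i\<close> are disjoint and cover all of
  \<open>{0<..\<theta>}\<close>, and the previous lemma applies to each of them.\<close>

lemma nn_integral_branches:
  assumes [measurable]: "F \<in> borel_measurable borel"
  shows "(\<integral>\<^sup>+x\<in>{0..\<theta>}. F x \<partial>lborel)
       = (\<integral>\<^sup>+y\<in>{0..\<theta>}. (\<Sum>i. F (branch i y) * ennreal ((branch i y)\<^sup>2)) \<partial>lborel)"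
proof -
  define B where "B i = {1 / (real (m + Suc i) * \<theta>)<..1 / (real (m + i) * \<theta>)}" for i
  have B_iff: "x \<in> B i \<longleftrightarrow> 0 < x \<and> digit x = int (m + i)" for x i
  proof -
    have "x \<in> B i \<longleftrightarrow> 0 < x \<and> real (m + i) \<le> 1 / (\<theta> * x) \<and> 1 / (\<theta> * x) < real (m + i) + 1"
    proof -
      define p where "p = real (m + i)"
      have p: "0 < p" using m_pos by (simp add: p_def)
      have "1 / ((p + 1) * \<theta>) < x \<and> x \<le> 1 / (p * \<theta>) \<longleftrightarrow> p \<le> 1 / (\<theta> * x) \<and> 1 / (\<theta> * x) < p + 1"
        if "0 < x"
        using that p theta_pos by (simp add: pos_divide_less_eq pos_le_divide_eq mult_ac conj_commute)
      moreover have "0 < 1 / ((p + 1) * \<theta>)" using p theta_pos by simp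
      moreover have "real (m + Suc i) = p + 1" by (simp add: p_def)
      ultimately show ?thesis
        unfolding B_def greaterThanAtMost_iff p_def[symmetric] by (metis less_trans)
    qed
    also have "\<dots> \<longleftrightarrow> 0 < x \<and> digit x = int (m + i)"
      unfolding digit_def floor_eq_iff by simp
    finally show ?thesis .
  qed
  have disj: "disjoint_family B"
    by (auto simp: disjoint_family_on_def B_iff)
  have union: "(\<Union>i. B i) = {0<..\<theta>}"
  proof (intro equalityI subsetI)
    fix x assume x: "x \<in> {0<..\<theta>}"
    hence "real m * (\<theta> * x) \<le> 1"
      using theta_pos by (simp add: m_theta mult.assoc[symmetric])
    hence "real m \<le> 1 / (\<theta> * x)"
      using x theta_pos by (simp add: field_simps)
    hence "int m \<le> digit x"
      unfolding digit_def by (simp add: le_floor_iff)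
    then obtain i where "digit x = int (m + i)"
      by (metis of_nat_add zle_iff_zadd)
    thus "x \<in> (\<Union>i. B i)" using x B_iff by auto
  next
    fix x assume "x \<in> (\<Union>i. B i)"
    then obtain i where i: "x \<in> B i" by auto
    hence "x \<le> branch i 0" by (simp add: B_def branch_def)
    also have "\<dots> \<le> \<theta>" using branch_range[of 0 i] by simp
    finally show "x \<in> {0<..\<theta>}" using i B_iff by auto
  qed
  have "(\<integral>\<^sup>+x\<in>{0..\<theta>}. F x \<partial>lborel) = (\<integral>\<^sup>+x\<in>(\<Union>i. B i). F x \<partial>lborel)"
    unfolding union
    by (rule nn_integral_cong_AE, use AE_lborel_singleton[of 0] in eventually_elim)
       (auto simp: indicator_def)
  also have "\<dots> = (\<Sum>i. \<integral>\<^sup>+x\<in>B i. F x \<partial>lborel)"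
    by (rule nn_integral_disjoint_family[OF _ _ disj]) (auto simp: B_def)
  also have "\<dots> = (\<Sum>i. \<integral>\<^sup>+y\<in>{0..\<theta>}. F (branch i y) * ennreal ((branch i y)\<^sup>2) \<partial>lborel)"
    unfolding B_def by (simp only: nn_integral_branch[OF assms])
  also have "\<dots> = (\<integral>\<^sup>+y. (\<Sum>i. F (branch i y) * ennreal ((branch i y)\<^sup>2)
                      * indicator {0..\<theta>} y) \<partial>lborel)"
    by (rule nn_integral_suminf[symmetric]) measurable
  finally show ?thesis by simp
qed

text \<open>The transfer operator of \<open>T\<close> applied to \<open>f\<close> weighted by a function \<open>w\<close> of the first digit.\<close>

definition transfer :: "(int \<Rightarrow> ennreal) \<Rightarrow> (real \<Rightarrow> ennreal) \<Rightarrow> real \<Rightarrow> ennreal" where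
  "transfer w f y = (\<Sum>i. f (branch i y) * w (int (m + i)) * ennreal ((branch i y)\<^sup>2))"

lemma transfer_measurable [measurable]:
  assumes [measurable]: "f \<in> borel_measurable borel"
  shows "transfer w f \<in> borel_measurable borel"
  unfolding transfer_def by measurable

text \<open>The duality between composition with \<open>T\<close> and its transfer operator: along
  \<open>branch i\<close> the digit is constant and \<open>T\<close> returns \<open>y\<close>, so
  \<open>g y\<close> can be pulled out of the sum over the branches.\<close>

lemma nn_integral_transfer:
  assumes [measurable]: "f \<in> borel_measurable borel" "g \<in> borel_measurable borel"
  shows "(\<integral>\<^sup>+x\<in>{0..\<theta>}. f x * w (digit x) * g (T x) \<partial>lborel) = (\<integral>\<^sup>+y\<in>{0..\<theta>}. transfer w f y * g y \<partial>lborel)"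
proof -
  have "(\<integral>\<^sup>+x\<in>{0..\<theta>}. f x * w (digit x) * g (T x) \<partial>lborel)
     = (\<integral>\<^sup>+y\<in>{0..\<theta>}. (\<Sum>i. f (branch i y) * w (digit (branch i y)) * g (T (branch i y)) *
          ennreal ((branch i y)\<^sup>2)) \<partial>lborel)"
    by (rule nn_integral_branches) measurable
  also have "\<dots> = (\<integral>\<^sup>+y\<in>{0..\<theta>}. transfer w f y * g y \<partial>lborel)"
  proof (rule nn_integral_cong_AE, use AE_lborel_singleton[of \<theta>] in eventually_elim)
    fix y assume "y \<noteq> \<theta>"
    have "(\<Sum>i. f (branch i y) * w (digit (branch i y)) * g (T (branch i y)) *
          ennreal ((branch i y)\<^sup>2)) = transfer w f y * g y" if "y \<in> {0..\<theta>}"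
      using that \<open>y \<noteq> \<theta>\<close> unfolding transfer_def
      by (subst ennreal_suminf_multc[symmetric], intro suminf_cong)
         (simp add: digit_branch T_branch mult_ac del: of_nat_add)
    thus "(\<Sum>i. f (branch i y) * w (digit (branch i y)) * g (T (branch i y)) *
          ennreal ((branch i y)\<^sup>2)) * indicator {0..\<theta>} y = transfer w f y * g y * indicator {0..\<theta>} y"
      by (auto simp: indicator_def)
  qed
  finally show ?thesis .
qed

section \<open>The invariant density and its measure\<close>

definition inv_density :: "real \<Rightarrow> ennreal" where
  "inv_density x = ennreal (1 / (1 + \<theta> * x))"

lemma inv_density_measurable [measurable]: "inv_density \<in> borel_measurable borel"
  unfolding inv_density_def by measurable

text \<open>The series telescopes, because the term with denominator \<open>c\<close> equals
  \<open>1 / (c * (c + \<theta>))\<close>, a difference of consecutive values of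
  \<open>1 / (\<theta> * c)\<close>. The first of these values is the density itself, by
  \<open>m_theta\<close>.\<close>

lemma transfer_inv_density:
  assumes y: "0 \<le> y"
  shows "transfer (\<lambda>_. 1) inv_density y = inv_density y"
proof -
  define u where "u i = branch i y / \<theta>" for i
  have "u \<longlonglongrightarrow> 0"
    unfolding u_def branch_def using theta_pos by real_asymp
  hence "(\<lambda>i. u i - u (Suc i)) sums (u 0 - 0)"
    by (rule telescope_sums')
  moreover have "u 0 = 1 / (1 + \<theta> * y)"
    using theta_pos m_theta by (simp add: u_def branch_def field_simps)
  moreover have "u i - u (Suc i) = 1 / (1 + \<theta> * branch i y) * (branch i y)\<^sup>2" for i
  proof -
    define c where "c = real (m + i) * \<theta> + y"
    have c: "0 < c" using branch_denom_pos[OF y] by (simp add: c_def)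
    define d where "d = c + \<theta>"
    have d: "0 < d" using c theta_pos by (simp add: d_def)
    have s: "u (Suc i) = 1 / (\<theta> * d)" "u i = 1 / (\<theta> * c)" "branch i y = 1 / c"
      by (simp_all add: u_def c_def d_def branch_def algebra_simps)
    have "u i - u (Suc i) = (d - c) / (\<theta> * c * d)"
      unfolding s using c d theta_pos by (simp add: field_simps)
    also have "\<dots> = 1 / (d / c) * (1 / c)\<^sup>2"
      using c d theta_pos by (simp add: d_def power2_eq_square)
    also have "d / c = 1 + \<theta> * branch i y"
      unfolding s using c by (simp add: d_def field_simps)
    finally show ?thesis by (simp add: s(3))
  qed
  ultimately have *: "(\<lambda>i. 1 / (1 + \<theta> * branch i y) * (branch i y)\<^sup>2) sums (1 / (1 + \<theta> * y))"
    by simp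
  have nonneg: "0 \<le> 1 / (1 + \<theta> * branch i y)" for i
    using branch_range[OF y, of i] theta_pos by simp
  have "transfer (\<lambda>_. 1) inv_density y
      = (\<Sum>i. ennreal (1 / (1 + \<theta> * branch i y) * (branch i y)\<^sup>2))"
    unfolding transfer_def inv_density_def ennreal_mult'[OF nonneg] by simp
  also have "\<dots> = ennreal (1 / (1 + \<theta> * y))"
    using * nonneg by (intro suminf_ennreal_eq) auto
  finally show ?thesis by (simp add: inv_density_def)
qed

text \<open>This is \<open>gamma_theta\<close> up to the factor
  \<open>\<theta> / ln (1 + \<theta>\<^sup>2)\<close>, placed on the whole real line so that
  \<open>T\<close> maps the underlying space to itself.\<close>

definition inv_measure :: "real measure" where
  "inv_measure = density lborel (\<lambda>x. inv_density x * indicator {0..\<theta>} x)"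

lemma space_inv_measure [simp]: "space inv_measure = UNIV"
  by (simp add: inv_measure_def)

lemma sets_inv_measure [simp, measurable_cong]: "sets inv_measure = sets borel"
  by (simp add: inv_measure_def)

lemma nn_integral_inv_measure:
  assumes [measurable]: "f \<in> borel_measurable borel"
  shows "(\<integral>\<^sup>+x. f x \<partial>inv_measure) = (\<integral>\<^sup>+x\<in>{0..\<theta>}. inv_density x * f x \<partial>lborel)"
  unfolding inv_measure_def by (subst nn_integral_density) (auto intro!: nn_integral_cong simp: mult_ac)

lemma distr_T: "distr inv_measure inv_measure T = inv_measure"
proof (rule measure_eqI)
  fix A assume "A \<in> sets (distr inv_measure inv_measure T)"
  hence [measurable]: "A \<in> sets borel" by simp
  have "emeasure (distr inv_measure inv_measure T) A = (\<integral>\<^sup>+x. indicator A (T x) \<partial>inv_measure)"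
    by (subst nn_integral_distr[where f = "indicator A" and T = T and M' = inv_measure, symmetric]) auto
  also have "\<dots> = (\<integral>\<^sup>+y\<in>{0..\<theta>}. transfer (\<lambda>_. 1) inv_density y * indicator A y \<partial>lborel)"
    using nn_integral_transfer[of inv_density "indicator A" "\<lambda>_. 1"]
    by (simp add: nn_integral_inv_measure)
  also have "\<dots> = (\<integral>\<^sup>+y. indicator A y \<partial>inv_measure)"
    by (subst nn_integral_inv_measure) (auto intro!: nn_integral_cong simp: transfer_inv_density indicator_def)
  finally show "emeasure (distr inv_measure inv_measure T) A = emeasure inv_measure A" by simp
qed simp

lemma emeasure_inv_measure_le:
  assumes [measurable]: "A \<in> sets borel"
  shows "emeasure inv_measure A \<le> emeasure lborel (A \<inter> {0..\<theta>})"
proof -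
  have "emeasure inv_measure A = (\<integral>\<^sup>+x\<in>{0..\<theta>}. inv_density x * indicator A x \<partial>lborel)"
    by (subst nn_integral_inv_measure[symmetric]) auto
  also have "\<dots> \<le> (\<integral>\<^sup>+x. indicator (A \<inter> {0..\<theta>}) x \<partial>lborel)"
    using theta_pos
    by (intro nn_integral_mono) (auto simp: indicator_def inv_density_def divide_le_eq add_pos_nonneg)
  finally show ?thesis by simp
qed

lemma finite_inv_measure: "finite_measure inv_measure"
  using emeasure_inv_measure_le[of UNIV] theta_pos
  by (intro finite_measureI) (auto simp: top_unique)

text \<open>The density is strictly positive on \<open>{0..\<theta>}\<close>, so the null sets there
  are those of Lebesgue measure.\<close>

lemma AE_inv_measure_iff: "(AE x in inv_measure. P x) \<longleftrightarrow> (AE x in lborel. x \<in> {0..\<theta>} \<longrightarrow> P x)"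
proof -
  have "0 < inv_density x * indicator {0..\<theta>} x \<longleftrightarrow> x \<in> {0..\<theta>}" for x
    using theta_pos
    by (auto simp: inv_density_def indicator_def zero_less_mult_iff ennreal_zero_less_mult_iff add_pos_nonneg)
  thus ?thesis unfolding inv_measure_def by (subst AE_density) auto
qed

end

section \<open>Bounded distortion and large digits\<close>

context theta_map
begin

text \<open>The fixed point of \<open>L \<mapsto> \<theta>\<^sup>2 * L + 2 * \<theta>\<close>: a
  branch contracts by \<open>\<theta>\<^sup>2\<close>, and the logarithm of its Jacobian is
  Lipschitz with constant \<open>2 * \<theta>\<close>.\<close>

definition distortion :: real where "distortion = 2 * \<theta> / (1 - \<theta>\<^sup>2)"

lemma theta_square_less_1: "\<theta>\<^sup>2 < 1"
  using theta_pos theta_less_1 by (simp add: power_less_one_iff)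

lemma distortion_nonneg: "0 \<le> distortion"
  using theta_pos theta_square_less_1 by (simp add: distortion_def)

lemma distortion_fixed_point: "distortion * \<theta>\<^sup>2 + 2 * \<theta> = distortion"
proof -
  have "distortion * (1 - \<theta>\<^sup>2) = 2 * \<theta>"
    using theta_square_less_1 by (simp add: distortion_def)
  thus ?thesis by (simp add: algebra_simps)
qed

text \<open>The logarithm of \<open>f\<close> is Lipschitz with constant \<open>distortion\<close>.
  The multiplicative form avoids logarithms, so it also makes sense where \<open>f\<close> is zero
  or infinite.\<close>

definition distortion_bounded :: "(real \<Rightarrow> ennreal) \<Rightarrow> bool" where
  "distortion_bounded f \<longleftrightarrow>
     (\<forall>x\<in>{0..\<theta>}. \<forall>y\<in>{0..\<theta>}. f x \<le> ennreal (exp (distortion * \<bar>x - y\<bar>)) * f y)"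

lemma distortion_boundedD:
  "distortion_bounded f \<Longrightarrow> 0 \<le> x \<Longrightarrow> x \<le> \<theta> \<Longrightarrow> 0 \<le> y \<Longrightarrow> y \<le> \<theta> \<Longrightarrow>
     f x \<le> ennreal (exp (distortion * \<bar>x - y\<bar>)) * f y"
  by (simp add: distortion_bounded_def)

lemma branch_contraction:
  assumes "0 \<le> x" "0 \<le> y"
  shows "\<bar>branch i x - branch i y\<bar> \<le> \<theta>\<^sup>2 * \<bar>x - y\<bar>"
proof -
  have "branch i x - branch i y = (y - x) * (branch i x * branch i y)"
    using branch_denom_pos[OF assms(1), of i] branch_denom_pos[OF assms(2), of i]
    by (simp add: branch_def field_simps)
  hence "\<bar>branch i x - branch i y\<bar> = \<bar>x - y\<bar> * (branch i x * branch i y)"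
    using branch_range[OF assms(1), of i] branch_range[OF assms(2), of i]
    by (simp add: abs_mult abs_minus_commute)
  also have "\<dots> \<le> \<bar>x - y\<bar> * (\<theta> * \<theta>)"
    using branch_range[OF assms(1), of i] branch_range[OF assms(2), of i]
    by (intro mult_left_mono mult_mono) auto
  finally show ?thesis by (simp add: power2_eq_square mult.commute)
qed

lemma branch_square_distortion:
  assumes "0 \<le> x" "0 \<le> y"
  shows "(branch i x)\<^sup>2 \<le> exp (2 * \<theta> * \<bar>x - y\<bar>) * (branch i y)\<^sup>2"
proof -
  note rng = branch_range[OF assms(1), of i] branch_range[OF assms(2), of i]
  \<comment> \<open>The ratio of the two values is \<open>1 + (y - x) * branch i x\<close>, which is
    at most \<open>exp (\<theta> * \<bar>x - y\<bar>)\<close>; squaring doubles the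
    exponent.\<close>
  have "branch i x = branch i y * (1 + (y - x) * branch i x)"
    using branch_denom_pos[OF assms(1), of i] branch_denom_pos[OF assms(2), of i]
    by (simp add: branch_def field_simps)
  also have "(y - x) * branch i x \<le> \<bar>x - y\<bar> * \<theta>"
    using rng by (intro mult_mono) auto
  also have "1 + \<bar>x - y\<bar> * \<theta> \<le> exp (\<theta> * \<bar>x - y\<bar>)"
    using exp_ge_add_one_self[of "\<theta> * \<bar>x - y\<bar>"] by (simp add: mult.commute)
  finally have "branch i x \<le> branch i y * exp (\<theta> * \<bar>x - y\<bar>)"
    using rng by (simp add: mult_left_mono)
  hence "(branch i x)\<^sup>2 \<le> (branch i y * exp (\<theta> * \<bar>x - y\<bar>))\<^sup>2"
    using rng by (intro power_mono) auto
  also have "\<dots> = exp (2 * \<theta> * \<bar>x - y\<bar>) * (branch i y)\<^sup>2"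
    by (simp add: power_mult_distrib exp_double[symmetric] mult_ac)
  finally show ?thesis .
qed

text \<open>In each term the contraction reduces the constant of \<open>f\<close> to
  \<open>distortion * \<theta>\<^sup>2\<close> and the Jacobian adds \<open>2 * \<theta>\<close>,
  which gives \<open>distortion\<close> again. The weight depends on the digit alone and is the same
  factor at \<open>x\<close> and \<open>y\<close>, and the bound survives summation over the
  branches.\<close>

lemma transfer_distortion_bounded:
  assumes f: "distortion_bounded f"
  shows "distortion_bounded (transfer w f)"
  unfolding distortion_bounded_def
proof (intro ballI)
  fix x y assume xy: "x \<in> {0..\<theta>}" "y \<in> {0..\<theta>}"
  hence xy0: "0 \<le> x" "0 \<le> y" by simp_all
  have "f (branch i x) * w (int (m + i)) * ennreal ((branch i x)\<^sup>2)
      \<le> ennreal (exp (distortion * \<bar>x - y\<bar>)) * (f (branch i y) * w (int (m + i)) * ennreal ((branch i y)\<^sup>2))" for i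
  proof -
    have "f (branch i x) \<le> ennreal (exp (distortion * \<bar>branch i x - branch i y\<bar>)) * f (branch i y)"
      using branch_range[OF xy0(1), of i] branch_range[OF xy0(2), of i]
      by (intro distortion_boundedD[OF f]) simp_all
    also have "\<dots> \<le> ennreal (exp (distortion * (\<theta>\<^sup>2 * \<bar>x - y\<bar>))) * f (branch i y)"
      using branch_contraction[OF xy0, of i] distortion_nonneg
      by (intro mult_right_mono ennreal_leI) (auto intro: mult_left_mono)
    finally have 1: "f (branch i x) \<le> ennreal (exp (distortion * \<theta>\<^sup>2 * \<bar>x - y\<bar>)) * f (branch i y)"
      by (simp add: mult.assoc)
    have 2: "ennreal ((branch i x)\<^sup>2) \<le> ennreal (exp (2 * \<theta> * \<bar>x - y\<bar>)) * ennreal ((branch i y)\<^sup>2)"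
      using branch_square_distortion[OF xy0, of i]
      by (subst ennreal_mult'[symmetric]) (auto intro!: ennreal_leI)
    have "exp (distortion * \<theta>\<^sup>2 * \<bar>x - y\<bar>) * exp (2 * \<theta> * \<bar>x - y\<bar>) = exp (distortion * \<bar>x - y\<bar>)"
      by (subst exp_add[symmetric], subst distortion_fixed_point[symmetric]) (simp add: algebra_simps)
    hence 3: "ennreal (exp (distortion * \<theta>\<^sup>2 * \<bar>x - y\<bar>)) * ennreal (exp (2 * \<theta> * \<bar>x - y\<bar>))
        = ennreal (exp (distortion * \<bar>x - y\<bar>))"
      by (subst ennreal_mult'[symmetric]) auto
    have "f (branch i x) * w (int (m + i)) * ennreal ((branch i x)\<^sup>2)
      \<le> (ennreal (exp (distortion * \<theta>\<^sup>2 * \<bar>x - y\<bar>)) * f (branch i y)) * w (int (m + i)) *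
         (ennreal (exp (2 * \<theta> * \<bar>x - y\<bar>)) * ennreal ((branch i y)\<^sup>2))"
      by (intro mult_mono 1 2) auto
    thus ?thesis unfolding 3[symmetric] by (simp only: mult_ac)
  qed
  hence "transfer w f x \<le> (\<Sum>i. ennreal (exp (distortion * \<bar>x - y\<bar>)) *
      (f (branch i y) * w (int (m + i)) * ennreal ((branch i y)\<^sup>2)))"
    unfolding transfer_def by (intro suminf_le) auto
  thus "transfer w f x \<le> ennreal (exp (distortion * \<bar>x - y\<bar>)) * transfer w f y"
    unfolding transfer_def by simp
qed

text \<open>On \<open>{0..\<theta>}\<close> the function differs from \<open>f 0\<close> by a factor
  of at most \<open>E = exp (distortion * \<theta>)\<close> in either direction. Comparing the two
  integrals costs \<open>E\<close> twice, next to the ratio \<open>s / \<theta>\<close> of the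
  lengths.\<close>

lemma nn_integral_initial_ge:
  assumes f: "distortion_bounded f" and [measurable]: "f \<in> borel_measurable borel" and s: "0 \<le> s" "s \<le> \<theta>"
  shows "ennreal (exp (- 2 * distortion * \<theta>) * s / \<theta>) * (\<integral>\<^sup>+x\<in>{0..\<theta>}. f x \<partial>lborel) \<le> (\<integral>\<^sup>+x\<in>{0..s}. f x \<partial>lborel)"
proof -
  define E where "E = exp (distortion * \<theta>)"
  have E: "0 < E" by (simp add: E_def)
  have E2: "exp (- 2 * distortion * \<theta>) = inverse E * inverse E"
    by (simp add: E_def exp_minus[symmetric] exp_add[symmetric])
  have mono: "exp (distortion * \<bar>x - y\<bar>) \<le> E" if "0 \<le> x" "x \<le> \<theta>" "0 \<le> y" "y \<le> \<theta>" for x y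
    unfolding E_def using that distortion_nonneg by (auto intro!: mult_left_mono)
  have upper: "f x \<le> ennreal E * f 0" if "x \<in> {0..\<theta>}" for x
    by (rule order_trans[OF distortion_boundedD[OF f, of x 0]])
       (use that mono[of x 0] in \<open>auto intro!: mult_right_mono ennreal_leI\<close>)
  have lower: "ennreal (inverse E) * f 0 \<le> f x" if "x \<in> {0..\<theta>}" for x
  proof -
    have "f 0 \<le> ennreal E * f x"
      by (rule order_trans[OF distortion_boundedD[OF f, of 0 x]])
         (use that mono[of 0 x] in \<open>auto intro!: mult_right_mono ennreal_leI\<close>)
    hence "ennreal (inverse E) * f 0 \<le> ennreal (inverse E) * (ennreal E * f x)"
      by (intro mult_left_mono) auto
    also have "\<dots> = f x"
      using E by (simp add: mult.assoc[symmetric] ennreal_mult'[symmetric])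
    finally show ?thesis .
  qed
  have "(\<integral>\<^sup>+x\<in>{0..\<theta>}. f x \<partial>lborel) \<le> (\<integral>\<^sup>+x\<in>{0..\<theta>}. (ennreal E * f 0) \<partial>lborel)"
    using upper by (intro nn_integral_mono) (auto simp: indicator_def)
  also have "\<dots> = ennreal E * f 0 * ennreal \<theta>"
    using theta_pos by (simp add: nn_integral_cmult_indicator)
  finally have "ennreal (inverse E * inverse E * s / \<theta>) * (\<integral>\<^sup>+x\<in>{0..\<theta>}. f x \<partial>lborel)
      \<le> ennreal (inverse E * inverse E * s / \<theta>) * (ennreal E * f 0 * ennreal \<theta>)"
    by (intro mult_left_mono) auto
  also have "\<dots> = (ennreal (inverse E * inverse E * s / \<theta>) * ennreal E * ennreal \<theta>) * f 0"
    by (simp add: mult_ac)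
  also have "ennreal (inverse E * inverse E * s / \<theta>) * ennreal E * ennreal \<theta> = ennreal (inverse E) * ennreal s"
    using E theta_pos s by (simp add: ennreal_mult'[symmetric])
  also have "ennreal (inverse E) * ennreal s * f 0 = ennreal (inverse E) * f 0 * ennreal s"
    by (simp add: mult_ac)
  also have "\<dots> = (\<integral>\<^sup>+x\<in>{0..s}. (ennreal (inverse E) * f 0) \<partial>lborel)"
    using s by (simp add: nn_integral_cmult_indicator)
  also have "\<dots> \<le> (\<integral>\<^sup>+x\<in>{0..s}. f x \<partial>lborel)"
    using lower s by (intro nn_integral_mono) (auto simp: indicator_def)
  finally show ?thesis unfolding E2 .
qed

text \<open>In \<open>avoidance W c\<close>, the function \<open>f\<close> plays the role of the density of \<open>T\<^sup>k x\<close> conditioned on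
  the first \<open>k\<close> digits: whatever the history, the next digit lies outside \<open>W\<close> with probability
  at least \<open>c\<close>.\<close>

definition avoidance :: "int set \<Rightarrow> real \<Rightarrow> bool" where
  "avoidance W c \<longleftrightarrow> (\<forall>f. f \<in> borel_measurable borel \<longrightarrow> distortion_bounded f \<longrightarrow>
     (\<integral>\<^sup>+x\<in>{0..\<theta>}. f x \<partial>lborel) < \<infinity> \<longrightarrow>
     (\<integral>\<^sup>+x\<in>{0..\<theta>}. f x * indicator W (digit x) \<partial>lborel) \<le> ennreal (1 - c) * (\<integral>\<^sup>+x\<in>{0..\<theta>}. f x \<partial>lborel))"

lemma avoidance_UNIV: "avoidance UNIV 0"
  by (simp add: avoidance_def)

text \<open>The third condition on \<open>s\<close> makes every point strictly between
  \<open>0\<close> and \<open>s\<close> have a digit above \<open>t\<close>; the mass of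
  \<open>{0..s}\<close> is bounded below by \<open>nn_integral_initial_ge\<close>.\<close>

lemma avoidance_small_digits:
  assumes s: "0 \<le> s" "s \<le> \<theta>" "s * (\<theta> * (t + 1)) \<le> 1" and t: "0 \<le> t"
  shows "avoidance {d. real_of_int d \<le> t} (exp (- 2 * distortion * \<theta>) / \<theta> * s)"
  unfolding avoidance_def
proof (intro allI impI)
  fix f :: "real \<Rightarrow> ennreal"
  assume [measurable]: "f \<in> borel_measurable borel" and f: "distortion_bounded f"
    and fin: "(\<integral>\<^sup>+x\<in>{0..\<theta>}. f x \<partial>lborel) < \<infinity>"
  define W where "W = {d. real_of_int d \<le> t}"
  define c where "c = exp (- 2 * distortion * \<theta>) * s / \<theta>"
  define J where "J = (\<integral>\<^sup>+x\<in>{0..\<theta>}. f x \<partial>lborel)"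
  define A where "A = (\<integral>\<^sup>+x\<in>{0..\<theta>}. f x * indicator W (digit x) \<partial>lborel)"
  have "exp (- 2 * distortion * \<theta>) \<le> 1"
    using distortion_nonneg theta_pos by simp
  moreover have "s / \<theta> \<le> 1" using s theta_pos by simp
  moreover have "0 \<le> s / \<theta>" using s theta_pos by simp
  ultimately have c: "0 \<le> c" "c \<le> 1"
    using mult_le_one[of "exp (- 2 * distortion * \<theta>)" "s / \<theta>"] s theta_pos by (simp_all add: c_def)
  have large: "t < digit x" if "0 < x" "x < s" for x
  proof -
    have "x * (\<theta> * (t + 1)) < s * (\<theta> * (t + 1))"
      using that t theta_pos by (intro mult_strict_right_mono) auto
    hence "x * (\<theta> * (t + 1)) \<le> 1" using s by linarith
    hence "t + 1 \<le> 1 / (\<theta> * x)" using that theta_pos by (simp add: field_simps)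
    thus ?thesis unfolding digit_def by linarith
  qed
  have "A + (\<integral>\<^sup>+x\<in>{0..s}. f x \<partial>lborel)
      = (\<integral>\<^sup>+x. f x * indicator W (digit x) * indicator {0..\<theta>} x + f x * indicator {0..s} x \<partial>lborel)"
    unfolding A_def W_def by (rule nn_integral_add[symmetric]) measurable
  also have "\<dots> \<le> J"
    unfolding J_def
  \<comment> \<open>At \<open>0\<close> the digit is \<open>0\<close> by the convention for division
    and hence small; \<open>0\<close> and \<open>s\<close> are removed as null sets.\<close>
  proof (rule nn_integral_mono_AE, use AE_lborel_singleton[of 0] AE_lborel_singleton[of s] in eventually_elim)
    fix x assume "x \<noteq> 0" "x \<noteq> s"
    thus "f x * indicator W (digit x) * indicator {0..\<theta>} x + f x * indicator {0..s} x \<le> f x * indicator {0..\<theta>} x"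
      using large[of x] s by (cases "0 < x \<and> x < s") (auto simp: indicator_def W_def)
  qed
  finally have *: "A + (\<integral>\<^sup>+x\<in>{0..s}. f x \<partial>lborel) \<le> J" .
  have "ennreal c * J \<le> (\<integral>\<^sup>+x\<in>{0..s}. f x \<partial>lborel)"
    unfolding c_def J_def by (rule nn_integral_initial_ge[OF f _ s(1,2)]) measurable
  hence "A + ennreal c * J \<le> J"
    using * by (meson add_left_mono order_trans)
  also have "J = ennreal (1 - c) * J + ennreal c * J"
    using c by (simp flip: distrib_right ennreal_plus)
  finally have "ennreal c * J + A \<le> ennreal c * J + ennreal (1 - c) * J"
    by (simp only: add.commute)
  \<comment> \<open>Cancellation in \<open>ennreal\<close> needs a finite summand; here the
    integrability of \<open>f\<close> is used.\<close>
  moreover have "ennreal c * J \<noteq> \<infinity>"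
    using fin by (simp add: J_def ennreal_mult_eq_top_iff)
  ultimately have "A \<le> ennreal (1 - c) * J"
    by (subst (asm) ennreal_add_left_cancel_le) auto
  thus "(\<integral>\<^sup>+x\<in>{0..\<theta>}. f x * indicator {d. real_of_int d \<le> t} (digit x) \<partial>lborel)
     \<le> ennreal (1 - exp (- 2 * distortion * \<theta>) / \<theta> * s) * (\<integral>\<^sup>+x\<in>{0..\<theta>}. f x \<partial>lborel)"
    by (simp add: A_def J_def W_def c_def)
qed

text \<open>Induction over the number of digits, with \<open>f\<close>, \<open>W\<close> and
  \<open>c\<close> free. Transferring \<open>f\<close> restricted to first digits in
  \<open>W 0\<close> costs a factor \<open>1 - c 0\<close> and yields another function of bounded
  distortion, to which the shifted sequences apply.\<close>

lemma nn_integral_avoidance: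
  fixes W :: "nat \<Rightarrow> int set" and c :: "nat \<Rightarrow> real"
  assumes "f \<in> borel_measurable borel" "distortion_bounded f" "(\<integral>\<^sup>+x\<in>{0..\<theta>}. f x \<partial>lborel) < \<infinity>"
    and "\<And>k. avoidance (W k) (c k)"
  shows "(\<integral>\<^sup>+x\<in>{0..\<theta>}. f x * (\<Prod>k<n. indicator (W k) (digit ((T ^^ k) x))) \<partial>lborel)
     \<le> (\<Prod>k<n. ennreal (1 - c k)) * (\<integral>\<^sup>+x\<in>{0..\<theta>}. f x \<partial>lborel)"
  using assms
proof (induction n arbitrary: f W c)
  case (Suc n)
  note [measurable] = Suc.prems(1)
  define h where "h = transfer (indicator (W 0)) f"
  have [measurable]: "h \<in> borel_measurable borel" unfolding h_def by measurable
  have int_h: "(\<integral>\<^sup>+y\<in>{0..\<theta>}. h y \<partial>lborel) = (\<integral>\<^sup>+x\<in>{0..\<theta>}. f x * indicator (W 0) (digit x) \<partial>lborel)"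
    using nn_integral_transfer[of f "\<lambda>_. 1" "indicator (W 0)"] by (simp add: h_def)
  also have le: "\<dots> \<le> ennreal (1 - c 0) * (\<integral>\<^sup>+x\<in>{0..\<theta>}. f x \<partial>lborel)"
    using Suc.prems unfolding avoidance_def by blast
  finally have h_le: "(\<integral>\<^sup>+y\<in>{0..\<theta>}. h y \<partial>lborel) \<le> ennreal (1 - c 0) * (\<integral>\<^sup>+x\<in>{0..\<theta>}. f x \<partial>lborel)" .
  also have "\<dots> < \<infinity>" using Suc.prems(3) by (simp add: ennreal_mult_less_top)
  finally have h_fin: "(\<integral>\<^sup>+y\<in>{0..\<theta>}. h y \<partial>lborel) < \<infinity>" .
  define g where "g x = (\<Prod>k<n. indicator (W (Suc k)) (digit ((T ^^ k) x)) :: ennreal)" for x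
  have [measurable]: "g \<in> borel_measurable borel" unfolding g_def by measurable
  have "(\<Prod>k<Suc n. indicator (W k) (digit ((T ^^ k) x)) :: ennreal) = indicator (W 0) (digit x) * g (T x)" for x
    by (subst prod.lessThan_Suc_shift) (simp add: g_def funpow_swap1)
  hence "(\<integral>\<^sup>+x\<in>{0..\<theta>}. f x * (\<Prod>k<Suc n. indicator (W k) (digit ((T ^^ k) x))) \<partial>lborel)
      = (\<integral>\<^sup>+x\<in>{0..\<theta>}. f x * indicator (W 0) (digit x) * g (T x) \<partial>lborel)"
    by (simp add: mult.assoc)
  also have "\<dots> = (\<integral>\<^sup>+y\<in>{0..\<theta>}. h y * g y \<partial>lborel)"
    unfolding h_def by (rule nn_integral_transfer) measurable
  also have "\<dots> \<le> (\<Prod>k<n. ennreal (1 - c (Suc k))) * (\<integral>\<^sup>+y\<in>{0..\<theta>}. h y \<partial>lborel)"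
    unfolding g_def using Suc.prems h_fin
    by (intro Suc.IH) (auto simp: h_def intro: transfer_distortion_bounded)
  also have "\<dots> \<le> (\<Prod>k<n. ennreal (1 - c (Suc k))) * (ennreal (1 - c 0) * (\<integral>\<^sup>+x\<in>{0..\<theta>}. f x \<partial>lborel))"
    by (intro mult_left_mono h_le) auto
  also have "\<dots> = (\<Prod>k<Suc n. ennreal (1 - c k)) * (\<integral>\<^sup>+x\<in>{0..\<theta>}. f x \<partial>lborel)"
    by (subst prod.lessThan_Suc_shift) (simp only: mult_ac)
  finally show ?case .
qed simp

text \<open>A substitute for the second Borel-Cantelli lemma without independence: the exceptional
  set has measure at most \<open>exp (- (\<Sum>k<n. c k)) * \<theta>\<close> for all
  \<open>n\<close>. A positive measure \<open>r\<close> would bound all partial sums of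
  \<open>c\<close> by \<open>ln (\<theta> / r)\<close>.\<close>

lemma AE_digit_leaves:
  fixes W :: "nat \<Rightarrow> int set" and c :: "nat \<Rightarrow> real"
  assumes avoid: "\<And>k. avoidance (W k) (c k)" and c: "\<And>k. 0 \<le> c k" "\<And>k. c k \<le> 1" "\<not> summable c"
  shows "AE x in lborel. x \<in> {0..\<theta>} \<longrightarrow> (\<exists>k. digit ((T ^^ k) x) \<notin> W k)"
proof -
  define E where "E = {x \<in> {0..\<theta>}. \<forall>k. digit ((T ^^ k) x) \<in> W k}"
  have [measurable]: "E \<in> sets borel" unfolding E_def by measurable
  have one: "distortion_bounded (\<lambda>_. 1)"
    using distortion_nonneg by (auto simp: distortion_bounded_def)
  have bound: "emeasure lborel E \<le> ennreal (exp (- (\<Sum>k<n. c k)) * \<theta>)" for n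
  proof -
    have "emeasure lborel E = (\<integral>\<^sup>+x. indicator E x \<partial>lborel)" by simp
    also have "\<dots> \<le> (\<integral>\<^sup>+x\<in>{0..\<theta>}. 1 * (\<Prod>k<n. indicator (W k) (digit ((T ^^ k) x))) \<partial>lborel)"
      by (intro nn_integral_mono) (auto simp: E_def indicator_def)
    also have "\<dots> \<le> (\<Prod>k<n. ennreal (1 - c k)) * (\<integral>\<^sup>+x\<in>{0..\<theta>}. 1 \<partial>lborel)"
      using theta_pos by (intro nn_integral_avoidance one avoid) auto
    also have "\<dots> = ennreal ((\<Prod>k<n. 1 - c k) * \<theta>)"
      using theta_pos c by (simp add: prod_ennreal ennreal_mult'' )
    also have "(\<Prod>k<n. 1 - c k) \<le> (\<Prod>k<n. exp (- c k))"
      using c exp_ge_add_one_self[of "- c k" for k] by (intro prod_mono) auto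
    also have "\<dots> = exp (- (\<Sum>k<n. c k))"
      by (simp add: exp_sum sum_negf[symmetric])
    finally show ?thesis using theta_pos by (simp add: ennreal_leI mult_right_mono)
  qed
  have fin: "emeasure lborel E < \<infinity>"
    by (rule le_less_trans[OF bound[of 0]]) simp
  have "measure lborel E = 0"
  proof (rule ccontr)
    define r where "r = measure lborel E"
    assume "measure lborel E \<noteq> 0"
    hence r: "0 < r" unfolding r_def using measure_nonneg[of lborel E] by linarith
    have em: "emeasure lborel E = ennreal r"
      using fin by (simp add: r_def emeasure_eq_ennreal_measure)
    have "(\<Sum>k<n. c k) \<le> ln (\<theta> / r)" for n
    proof -
      have "r \<le> exp (- (\<Sum>k<n. c k)) * \<theta>"
        using bound[of n] theta_pos by (simp add: em)
      hence "exp (\<Sum>k<n. c k) \<le> \<theta> / r"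
        using r by (simp add: exp_minus field_simps)
      thus ?thesis using r theta_pos by (simp add: ln_ge_iff)
    qed
    hence "(\<Sum>k\<le>n. c k) \<le> ln (\<theta> / r)" for n
      unfolding lessThan_Suc_atMost[symmetric] .
    hence "summable c" using c by (intro bounded_imp_summable[of c]) auto
    thus False using c by blast
  qed
  hence "emeasure lborel E = 0"
    using fin by (simp add: emeasure_eq_ennreal_measure)
  hence "AE x in lborel. x \<notin> E"
    by (intro AE_I[of _ _ E]) auto
  thus ?thesis by eventually_elim (auto simp: E_def)
qed

end

section \<open>The maximal ergodic inequality\<close>

text \<open>The maximum of the ergodic sums of length at most \<open>n\<close>, including the empty
  sum, in the recursive form that suits Garsia's argument.\<close>

fun max_ergodic_sum :: "('a \<Rightarrow> 'a) \<Rightarrow> ('a \<Rightarrow> real) \<Rightarrow> nat \<Rightarrow> 'a \<Rightarrow> real" where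
  "max_ergodic_sum T g 0 x = 0"
| "max_ergodic_sum T g (Suc n) x = max 0 (g x + max_ergodic_sum T g n (T x))"

lemma max_ergodic_sum_mono: "max_ergodic_sum T g n x \<le> max_ergodic_sum T g (Suc n) x"
proof (induction n arbitrary: x)
  case (Suc n)
  show ?case
    unfolding max_ergodic_sum.simps(2)[of T g n] max_ergodic_sum.simps(2)[of T g "Suc n"]
    using Suc.IH[of "T x"] by (intro max.mono add_left_mono) auto
qed simp

lemma max_ergodic_sum_nonneg: "0 \<le> max_ergodic_sum T g n x"
  by (cases n) auto

lemma max_ergodic_sum_ge: "(\<Sum>k<n. g ((T ^^ k) x)) \<le> max_ergodic_sum T g n x"
proof (induction n arbitrary: x)
  case (Suc n)
  have "(\<Sum>k<Suc n. g ((T ^^ k) x)) = g x + (\<Sum>k<n. g ((T ^^ k) (T x)))"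
    by (subst sum.lessThan_Suc_shift) (simp add: funpow_swap1)
  also have "\<dots> \<le> g x + max_ergodic_sum T g n (T x)"
    using Suc.IH by simp
  finally show ?case by simp
qed simp

lemma integrable_measure_preserving_compose:
  fixes f :: "'a \<Rightarrow> real"
  assumes "T \<in> measurable M M" "distr M M T = M" "integrable M f"
  shows "integrable M (\<lambda>x. f (T x))"
  by (rule integrable_distr[OF assms(1)]) (use assms in simp)

lemma integral_measure_preserving_compose:
  fixes f :: "'a \<Rightarrow> real"
  assumes "T \<in> measurable M M" "distr M M T = M" "f \<in> borel_measurable M"
  shows "(\<integral>x. f (T x) \<partial>M) = (\<integral>x. f x \<partial>M)"
  using integral_distr[OF assms(1,3)] unfolding assms(2) by (rule sym)

lemma integrable_max_ergodic_sum:
  assumes "T \<in> measurable M M" "distr M M T = M" "integrable M g"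
  shows "integrable M (max_ergodic_sum T g n)"
proof (induction n)
  case (Suc n)
  have "integrable M (\<lambda>x. max 0 (g x + max_ergodic_sum T g n (T x)))"
    by (intro integrable_max Bochner_Integration.integrable_add integrable_zero assms(3)
        integrable_measure_preserving_compose[OF assms(1,2) Suc])
  moreover have "max_ergodic_sum T g (Suc n) = (\<lambda>x. max 0 (g x + max_ergodic_sum T g n (T x)))"
    by (rule ext) (rule max_ergodic_sum.simps)
  ultimately show ?case by (simp only:)
next
  case 0
  have "max_ergodic_sum T g 0 = (\<lambda>x. 0)"
    by (rule ext) (rule max_ergodic_sum.simps)
  thus ?case by simp
qed

text \<open>Garsia's proof: where the maximum \<open>G\<close> is positive it is at most
  \<open>g + G \<circ> T\<close>, and elsewhere it is zero while \<open>G \<circ> T\<close> is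
  nonnegative. So \<open>G - G \<circ> T\<close>, whose integral vanishes by invariance, is at most
  \<open>g\<close> times the indicator of that set.\<close>

lemma maximal_ergodic:
  assumes T: "T \<in> measurable M M" "distr M M T = M" and g: "integrable M g"
  shows "0 \<le> (\<integral>x. g x * indicator {x \<in> space M. 0 < max_ergodic_sum T g n x} x \<partial>M)"
proof -
  define G where "G = max_ergodic_sum T g n"
  define E where "E = {x \<in> space M. 0 < G x}"
  have G: "integrable M G"
    unfolding G_def by (rule integrable_max_ergodic_sum[OF T g])
  hence [measurable]: "G \<in> borel_measurable M" by auto
  have E: "E \<in> sets M" unfolding E_def by measurable
  have GT: "integrable M (\<lambda>x. G (T x))"
    by (rule integrable_measure_preserving_compose[OF T G])
  have le: "G x - G (T x) \<le> g x * indicator E x" if "x \<in> space M" for x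
  proof (cases "x \<in> E")
    case True
    then obtain k where n: "n = Suc k" by (cases n) (auto simp: E_def G_def)
    have "G x = g x + max_ergodic_sum T g k (T x)"
      using True by (simp add: E_def G_def n max_def split: if_splits)
    also have "\<dots> \<le> g x + G (T x)"
      using max_ergodic_sum_mono[of T g k "T x"] by (simp add: G_def n)
    finally show ?thesis using True by simp
  next
    case False
    hence "G x \<le> 0" using that by (simp add: E_def)
    thus ?thesis using False max_ergodic_sum_nonneg[of T g n "T x"] by (simp add: G_def)
  qed
  have "0 = (\<integral>x. G x - G (T x) \<partial>M)"
    using G GT by (simp add: integral_measure_preserving_compose[OF T])
  also have "\<dots> \<le> (\<integral>x. g x * indicator E x \<partial>M)"
    using le G GT g E by (intro integral_mono integrable_real_mult_indicator) auto
  finally show ?thesis unfolding E_def G_def .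
qed

text \<open>For \<open>g = f - c\<close> the maximal inequality says that \<open>c\<close> times the
  measure of \<open>E n\<close> is at most the integral of \<open>f\<close> over it. The sets
  \<open>E n\<close> increase with \<open>n\<close>, so the bound passes to their union.\<close>

lemma maximal_ergodic_weak_type:
  assumes T: "T \<in> measurable M M" "distr M M T = M" and "finite_measure M"
    and f: "integrable M f" "\<And>x. 0 \<le> f x" and c: "0 < c"
  obtains E where "E \<in> sets M" "{x \<in> space M. \<exists>n. c * real n < (\<Sum>k<n. f ((T ^^ k) x))} \<subseteq> E"
    "emeasure M E \<le> ennreal ((\<integral>x. f x \<partial>M) / c)"
proof -
  interpret finite_measure M by fact
  define g where "g x = f x - c" for x
  have g: "integrable M g" unfolding g_def using f by auto
  define E where "E n = {x \<in> space M. 0 < max_ergodic_sum T g n x}" for n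
  have [measurable]: "max_ergodic_sum T g n \<in> borel_measurable M" for n
    using integrable_max_ergodic_sum[OF T g] by auto
  have E: "E n \<in> sets M" for n unfolding E_def by measurable
  have "measure M (E n) \<le> (\<integral>x. f x \<partial>M) / c" for n
  proof -
    have "0 \<le> (\<integral>x. f x * indicator (E n) x - c * indicator (E n) x \<partial>M)"
      using maximal_ergodic[OF T g, of n] by (simp add: E_def g_def left_diff_distrib)
    also have "\<dots> = (\<integral>x. f x * indicator (E n) x \<partial>M) - c * measure M (E n)"
      using f(1) E by (subst Bochner_Integration.integral_diff)
        (simp_all add: integrable_real_mult_indicator less_top[symmetric])
    also have "(\<integral>x. f x * indicator (E n) x \<partial>M) \<le> (\<integral>x. f x \<partial>M)"
      using f E by (intro integral_mono integrable_real_mult_indicator) (auto simp: indicator_def)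
    finally show ?thesis using c by (simp add: field_simps)
  qed
  moreover have "(\<lambda>n. measure M (E n)) \<longlonglongrightarrow> measure M (\<Union>n. E n)"
  proof (rule finite_Lim_measure_incseq)
    show "incseq E"
      unfolding E_def incseq_Suc_iff using max_ergodic_sum_mono[of T g] by (blast intro: less_le_trans)
  qed (use E in auto)
  ultimately have "measure M (\<Union>n. E n) \<le> (\<integral>x. f x \<partial>M) / c"
    by (intro LIMSEQ_le_const2) auto
  hence "emeasure M (\<Union>n. E n) \<le> ennreal ((\<integral>x. f x \<partial>M) / c)"
    by (simp add: emeasure_eq_measure ennreal_leI)
  moreover have "{x \<in> space M. \<exists>n. c * real n < (\<Sum>k<n. f ((T ^^ k) x))} \<subseteq> (\<Union>n. E n)"
  proof safe
    fix x n assume x: "x \<in> space M" "c * real n < (\<Sum>k<n. f ((T ^^ k) x))"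
    hence "0 < (\<Sum>k<n. g ((T ^^ k) x))" by (simp add: g_def sum_subtractf mult.commute)
    hence "0 < max_ergodic_sum T g n x" using max_ergodic_sum_ge[of g T x n] by linarith
    thus "x \<in> (\<Union>n. E n)" using x by (auto simp: E_def)
  qed
  ultimately show ?thesis using that E by blast
qed

section \<open>Sums of digits on a summable scale\<close>

text \<open>A substitute for the inverse of the function \<open>n \<mapsto> n * b n\<close>. Each \<open>max n (x / b n) / x\<close> is
  nonincreasing in \<open>x\<close>, hence so is \<open>slow_inverse b x / x\<close>, which yields subadditivity.\<close>

definition slow_inverse :: "(nat \<Rightarrow> real) \<Rightarrow> real \<Rightarrow> real" where
  "slow_inverse b x = (INF n. max (real n) (x / b n))"

locale slow_scale =
  fixes b :: "nat \<Rightarrow> real"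
  assumes b_pos: "\<And>n. 0 < b n" and b_mono: "incseq b"
begin

abbreviation \<alpha> :: "real \<Rightarrow> real" where "\<alpha> \<equiv> slow_inverse b"

lemma slow_inverse_bdd: "bdd_below (range (\<lambda>n. max (real n) (x / b n)))"
  by (rule bdd_belowI[of _ 0]) auto

lemma alpha_le: "\<alpha> x \<le> max (real n) (x / b n)"
  unfolding slow_inverse_def by (rule cINF_lower[OF slow_inverse_bdd]) simp

lemma alpha_greatest: "(\<And>n. y \<le> max (real n) (x / b n)) \<Longrightarrow> y \<le> \<alpha> x"
  unfolding slow_inverse_def by (rule cINF_greatest) auto

lemma alpha_nonneg: "0 \<le> \<alpha> x"
  by (rule alpha_greatest) simp

lemma alpha_zero: "\<alpha> 0 = 0"
  using alpha_le[of 0 0] alpha_nonneg[of 0] by simp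

lemma alpha_mono: "mono \<alpha>"
proof (rule monoI)
  fix x y :: real assume "x \<le> y"
  hence "max (real n) (x / b n) \<le> max (real n) (y / b n)" for n
    using b_pos[of n] by (intro max.mono divide_right_mono) auto
  thus "\<alpha> x \<le> \<alpha> y"
    by (intro alpha_greatest order_trans[OF alpha_le])
qed

lemma alpha_measurable [measurable]: "\<alpha> \<in> borel_measurable borel"
  by (rule borel_measurable_mono[OF alpha_mono])

text \<open>The way back from a bound on \<open>\<alpha> x\<close> to a bound on \<open>x\<close>:
  an index that nearly attains the infimum.\<close>

lemma alpha_lessD:
  assumes "\<alpha> x < y"
  obtains n where "real n < y" "x < y * b n"
proof -
  obtain n where "max (real n) (x / b n) < y"
    using assms unfolding slow_inverse_def by (subst (asm) cINF_less_iff[OF _ slow_inverse_bdd]) auto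
  thus ?thesis using b_pos[of n] that[of n] by (simp add: pos_divide_less_eq)
qed

lemma alpha_scale:
  assumes "0 < x" "x \<le> y"
  shows "x * \<alpha> y \<le> y * \<alpha> x"
proof -
  have "x * \<alpha> y / y \<le> \<alpha> x"
  proof (rule alpha_greatest)
    fix n
    have "x * \<alpha> y / y \<le> x * max (real n) (y / b n) / y"
      using assms alpha_le[of y n] by (intro divide_right_mono mult_left_mono) auto
    also have "\<dots> = max (x / y * real n) (x / b n)"
      using assms by (simp add: max_mult_distrib_left max_divide_distrib_right)
    also have "\<dots> \<le> max (real n) (x / b n)"
      using assms mult_right_mono[of "x / y" 1 "real n"] by (intro max.mono) auto
    finally show "x * \<alpha> y / y \<le> max (real n) (x / b n)" .
  qed
  thus ?thesis using assms by (simp add: field_simps)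
qed

lemma alpha_subadditive:
  assumes "0 \<le> x" "0 \<le> y"
  shows "\<alpha> (x + y) \<le> \<alpha> x + \<alpha> y"
proof (cases "x = 0 \<or> y = 0")
  case True
  thus ?thesis using alpha_nonneg[of x] alpha_nonneg[of y] by auto
next
  case False
  hence xy: "0 < x" "0 < y" using assms by auto
  \<comment> \<open>Adding the two inequalities and cancelling \<open>x + y\<close> gives
    subadditivity.\<close>
  have "x * \<alpha> (x + y) \<le> (x + y) * \<alpha> x" "y * \<alpha> (x + y) \<le> (x + y) * \<alpha> y"
    using xy by (auto intro: alpha_scale)
  hence "(x + y) * \<alpha> (x + y) \<le> (x + y) * (\<alpha> x + \<alpha> y)"
    unfolding distrib_left distrib_right by linarith
  thus ?thesis using xy by simp
qed

lemma alpha_sum_le: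
  assumes "\<And>k. 0 \<le> f k"
  shows "\<alpha> (\<Sum>k<(n::nat). f k) \<le> (\<Sum>k<n. \<alpha> (f k))"
proof (induction n)
  case (Suc n)
  have "\<alpha> ((\<Sum>k<n. f k) + f n) \<le> \<alpha> (\<Sum>k<n. f k) + \<alpha> (f n)"
    using assms by (intro alpha_subadditive sum_nonneg) auto
  thus ?case using Suc by simp
qed (simp add: alpha_zero)

end

section \<open>Consequences of convergence of the series\<close>

locale summable_scale = slow_scale +
  assumes summable_scale: "summable (\<lambda>n. 1 / (real (Suc n) * b (Suc n)))"
begin

text \<open>If \<open>b\<close> were bounded, comparison would make the harmonic series
  converge.\<close>

lemma b_unbounded:
  obtains j where "K < b j"
proof (rule ccontr)
  assume "\<not> thesis"
  hence le: "b j \<le> K" for j using that[of j] by (simp add: not_less[symmetric]) blast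
  have K: "0 < K" using le[of 0] b_pos[of 0] by linarith
  have "summable (\<lambda>n. 1 / (real (Suc n) * K))"
  proof (rule summable_comparison_test'[OF summable_scale, of 0])
    fix n
    show "norm (1 / (real (Suc n) * K)) \<le> 1 / (real (Suc n) * b (Suc n))"
      using le[of "Suc n"] b_pos[of "Suc n"] K
      by (simp add: divide_left_mono mult_left_mono del: of_nat_Suc)
  qed
  hence "summable (\<lambda>n. K * (1 / (real (Suc n) * K)))" by (rule summable_mult)
  also have "(\<lambda>n. K * (1 / (real (Suc n) * K))) = (\<lambda>n. inverse (real (Suc n)))"
    using K by (simp add: inverse_eq_divide del: of_nat_Suc)
  finally have "summable (\<lambda>n. inverse (real n))" by (subst (asm) summable_Suc_iff)
  thus False using not_summable_harmonic[where 'a = real] by simp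
qed

lemma alpha_sublinear:
  assumes c: "0 < c" and M: "0 \<le> M"
  shows "\<forall>\<^sub>F n in sequentially. \<alpha> (M * real n) < c * real n"
proof -
  \<comment> \<open>One fixed index \<open>j\<close> in the infimum suffices: the term
    \<open>M * n / b j\<close> has slope below \<open>c\<close>, and the constant \<open>j\<close>
    is eventually below \<open>c * n\<close>.\<close>
  obtain j where j: "M / c < b j" by (rule b_unbounded)
  have "\<forall>\<^sub>F n in sequentially. real j / c < real n" by real_asymp
  thus ?thesis
  proof eventually_elim
    case (elim n)
    hence "0 < real n" using c by (smt (verit) divide_nonneg_pos of_nat_0_le_iff)
    have "M < c * b j" using j c by (simp add: field_simps)
    hence "M * real n < c * b j * real n" using \<open>0 < real n\<close> by simp
    hence "M * real n / b j < c * real n" using b_pos[of j] by (simp add: pos_divide_less_eq mult_ac)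
    moreover have "real j < c * real n" using elim c by (simp add: field_simps)
    ultimately show ?case using alpha_le[of "M * real n" j] by linarith
  qed
qed

end

section \<open>Tail of the digit distribution and integrability of its image under \<alpha>\<close>

context theta_map
begin

lemma emeasure_digit_gt:
  assumes "0 < t"
  shows "emeasure inv_measure {x. t < real_of_int (digit x)} \<le> ennreal (1 / (\<theta> * t))"
proof -
  have "emeasure inv_measure {x. t < real_of_int (digit x)}
      \<le> emeasure lborel ({x. t < real_of_int (digit x)} \<inter> {0..\<theta>})"
    by (rule emeasure_inv_measure_le) measurable
  also have "\<dots> \<le> emeasure lborel {0..1 / (\<theta> * t)}"
  proof (rule emeasure_mono)
    show "{x. t < real_of_int (digit x)} \<inter> {0..\<theta>} \<subseteq> {0..1 / (\<theta> * t)}"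
    proof
      fix x assume x: "x \<in> {x. t < real_of_int (digit x)} \<inter> {0..\<theta>}"
      hence "t < 1 / (\<theta> * x)" unfolding digit_def by (auto intro: less_le_trans[OF _ of_int_floor_le])
      moreover from this have "0 < x" using x assms by (cases "x = 0") auto
      ultimately show "x \<in> {0..1 / (\<theta> * t)}" using theta_pos assms by (simp add: field_simps)
    qed
  qed simp
  also have "\<dots> = ennreal (1 / (\<theta> * t))" using assms theta_pos by simp
  finally show ?thesis .
qed

end

locale summable_theta = theta_map + summable_scale
begin

text \<open>Layer-cake summation for the ceiling of \<open>\<alpha> (digit x)\<close>: exceeding
  \<open>j\<close> forces the digit above \<open>j * b j\<close>, an event of measure at most
  \<open>1 / (\<theta> * j * b j)\<close>, and these bounds are summable.\<close>

lemma integrable_alpha_digit: "integrable inv_measure (\<lambda>x. \<alpha> (real_of_int (digit x)))"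
proof (rule integrableI_bounded)
  define f where "f x = nat \<lceil>\<alpha> (real_of_int (digit x))\<rceil>" for x
  have [measurable]: "f \<in> measurable inv_measure (count_space UNIV)" unfolding f_def by measurable
  \<comment> \<open>The tail bound says nothing at \<open>j = 0\<close>, so the total mass is used
    there.\<close>
  define d where "d j = (if j = 0 then measure inv_measure UNIV else 1 / \<theta> * (1 / (real j * b j)))" for j
  interpret finite_measure inv_measure by (rule finite_inv_measure)
  have d_nonneg: "0 \<le> d j" for j using theta_pos b_pos[of j] by (simp add: d_def)
  have "summable (\<lambda>j. d (Suc j))"
    unfolding d_def using summable_mult[OF summable_scale, of "1 / \<theta>"] by simp
  hence d_summable: "summable d" by (subst (asm) summable_Suc_iff)
  have le: "emeasure inv_measure {x \<in> space inv_measure. j < f x} \<le> ennreal (d j)" for j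
  proof (cases "j = 0")
    case True
    show ?thesis unfolding d_def using True emeasure_eq_measure[of UNIV]
      by (auto simp: measure_def intro!: emeasure_mono order_trans[OF emeasure_mono[of _ UNIV]])
  next
    case False
    have "{x \<in> space inv_measure. j < f x} \<subseteq> {x. real j * b j < real_of_int (digit x)}"
    proof
      fix x assume "x \<in> {x \<in> space inv_measure. j < f x}"
      hence "real j < \<alpha> (real_of_int (digit x))" by (simp add: f_def zless_nat_eq_int_zless less_ceiling_iff)
      also note alpha_le[of _ j]
      finally show "x \<in> {x. real j * b j < real_of_int (digit x)}"
        using b_pos[of j] by (auto simp: less_max_iff_disj pos_less_divide_eq)
    qed
    hence "emeasure inv_measure {x \<in> space inv_measure. j < f x}
       \<le> emeasure inv_measure {x. real j * b j < real_of_int (digit x)}"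
      by (rule emeasure_mono) measurable
    also have "\<dots> \<le> ennreal (1 / (\<theta> * (real j * b j)))"
      using False b_pos[of j] by (intro emeasure_digit_gt) simp
    finally show ?thesis using False by (simp add: d_def)
  qed
  have "(\<integral>\<^sup>+x. ennreal (norm (\<alpha> (real_of_int (digit x)))) \<partial>inv_measure) \<le> (\<integral>\<^sup>+x. of_nat (f x) \<partial>inv_measure)"
  proof (rule nn_integral_mono)
    fix x
    have "\<alpha> (real_of_int (digit x)) \<le> real (f x)" unfolding f_def by linarith
    thus "ennreal (norm (\<alpha> (real_of_int (digit x)))) \<le> of_nat (f x)"
      using alpha_nonneg by (simp add: ennreal_of_nat_eq_real_of_nat ennreal_leI)
  qed
  also have "\<dots> = (\<Sum>j. emeasure inv_measure {x \<in> space inv_measure. j < f x})"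
    by (rule nn_integral_nat_function) measurable
  also have "\<dots> \<le> (\<Sum>j. ennreal (d j))"
    using le by (intro suminf_le) auto
  also have "\<dots> < \<infinity>"
    using ennreal_suminf_neq_top[OF d_summable d_nonneg] by (simp add: less_top)
  finally show "(\<integral>\<^sup>+x. ennreal (norm (\<alpha> (real_of_int (digit x)))) \<partial>inv_measure) < \<infinity>" .
qed measurable

definition tail :: "nat \<Rightarrow> real \<Rightarrow> real" where
  "tail M x = (if real M < real_of_int (digit x) then real_of_int (digit x) else 0)"

lemma tail_measurable [measurable]: "tail M \<in> borel_measurable borel"
  unfolding tail_def by measurable

lemma alpha_tail_le: "\<alpha> (tail M x) \<le> \<alpha> (real_of_int (digit x))"
  using alpha_nonneg by (simp add: tail_def alpha_zero)

lemma integrable_alpha_tail: "integrable inv_measure (\<lambda>x. \<alpha> (tail M x))"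
  by (rule Bochner_Integration.integrable_bound[OF integrable_alpha_digit])
     (use alpha_nonneg alpha_tail_le in auto)

text \<open>Dominated convergence: at each point the tail vanishes once \<open>M\<close> reaches the
  digit.\<close>

lemma integral_alpha_tail: "(\<lambda>M. \<integral>x. \<alpha> (tail M x) \<partial>inv_measure) \<longlonglongrightarrow> 0"
proof -
  have "(\<lambda>M. \<integral>x. \<alpha> (tail M x) \<partial>inv_measure) \<longlonglongrightarrow> (\<integral>x. 0 \<partial>inv_measure)"
  proof (rule integral_dominated_convergence[OF _ _ integrable_alpha_digit])
    show "AE x in inv_measure. (\<lambda>M. \<alpha> (tail M x)) \<longlonglongrightarrow> 0"
    proof (intro AE_I2 tendsto_eventually)
      fix x
      have "\<forall>\<^sub>F M in sequentially. real_of_int (digit x) < real M" by real_asymp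
      thus "\<forall>\<^sub>F M in sequentially. \<alpha> (tail M x) = 0"
        by eventually_elim (simp add: tail_def alpha_zero)
    qed
  qed (use alpha_nonneg alpha_tail_le in auto)
  thus ?thesis by simp
qed

lemma AE_alpha_sum_small:
  assumes c: "0 < c"
  shows "AE x in inv_measure. \<forall>\<^sub>F n in sequentially. \<alpha> (\<Sum>k<n. real_of_int (digit ((T ^^ k) x))) < c * real n"
proof -
  \<comment> \<open>Half of \<open>c\<close> is spent on the digits above \<open>M\<close>; the
    other half will absorb \<open>\<alpha> (M * n)\<close>.\<close>
  define A where "A M = {x \<in> space inv_measure. \<exists>n. c / 2 * real n < (\<Sum>k<n. \<alpha> (tail M ((T ^^ k) x)))}" for M
  have "\<exists>E. E \<in> sets inv_measure \<and> A M \<subseteq> E \<and>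
      emeasure inv_measure E \<le> ennreal ((\<integral>x. \<alpha> (tail M x) \<partial>inv_measure) / (c / 2))" for M
  proof (rule maximal_ergodic_weak_type[OF _ distr_T finite_inv_measure integrable_alpha_tail[of M] alpha_nonneg])
    show "T \<in> inv_measure \<rightarrow>\<^sub>M inv_measure" by measurable
    show "0 < c / 2" using c by simp
  qed (unfold A_def, blast)
  then obtain E where E: "E M \<in> sets inv_measure" "A M \<subseteq> E M"
      "emeasure inv_measure (E M) \<le> ennreal ((\<integral>x. \<alpha> (tail M x) \<partial>inv_measure) / (c / 2))" for M
    using choice[of "\<lambda>M E. E \<in> sets inv_measure \<and> A M \<subseteq> E \<and>
      emeasure inv_measure E \<le> ennreal ((\<integral>x. \<alpha> (tail M x) \<partial>inv_measure) / (c / 2))"] by blast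
  have lim: "(\<lambda>M. ennreal ((\<integral>x. \<alpha> (tail M x) \<partial>inv_measure) / (c / 2))) \<longlonglongrightarrow> ennreal (0 / (c / 2))"
    using c by (intro tendsto_ennrealI tendsto_divide integral_alpha_tail tendsto_const) auto
  have "emeasure inv_measure (\<Inter>M. E M) \<le> ennreal ((\<integral>x. \<alpha> (tail M x) \<partial>inv_measure) / (c / 2))" for M
    by (rule order_trans[OF emeasure_mono E(3)]) (use E(1) in auto)
  hence "emeasure inv_measure (\<Inter>M. E M) \<le> ennreal (0 / (c / 2))"
    by (intro LIMSEQ_le_const[OF lim]) auto
  hence "(\<Inter>M. E M) \<in> null_sets inv_measure"
    using E(1) by (intro null_setsI) auto
  hence "AE x in inv_measure. x \<notin> (\<Inter>M. E M)" by (rule AE_not_in)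
  moreover have "AE x in inv_measure. x \<in> {0..\<theta>}" by (simp add: AE_inv_measure_iff)
  ultimately show ?thesis
  proof eventually_elim
    case (elim x)
    \<comment> \<open>This \<open>M\<close> depends on \<open>x\<close>, but the resulting bound
      holds for all \<open>n\<close> at once.\<close>
    then obtain M where "x \<notin> A M" using E(2) by blast
    hence M: "(\<Sum>k<n. \<alpha> (tail M ((T ^^ k) x))) \<le> c / 2 * real n" for n
      unfolding A_def by (simp add: not_less)
    have "\<forall>\<^sub>F n in sequentially. \<alpha> (real M * real n) < c / 2 * real n"
      using c by (intro alpha_sublinear) auto
    thus ?case
    proof eventually_elim
      case (elim n)
      have nonneg: "0 \<le> tail M y" for y by (simp add: tail_def)
      have "(\<Sum>k<n. real_of_int (digit ((T ^^ k) x))) \<le> (\<Sum>k<n. real M + tail M ((T ^^ k) x))"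
        by (intro sum_mono) (simp add: tail_def)
      hence "\<alpha> (\<Sum>k<n. real_of_int (digit ((T ^^ k) x))) \<le> \<alpha> (real M * real n + (\<Sum>k<n. tail M ((T ^^ k) x)))"
        by (intro monoD[OF alpha_mono]) (simp add: sum.distrib mult.commute)
      also have "\<dots> \<le> \<alpha> (real M * real n) + \<alpha> (\<Sum>k<n. tail M ((T ^^ k) x))"
        using nonneg by (intro alpha_subadditive sum_nonneg) auto
      also have "\<alpha> (\<Sum>k<n. tail M ((T ^^ k) x)) \<le> (\<Sum>k<n. \<alpha> (tail M ((T ^^ k) x)))"
        using nonneg by (rule alpha_sum_le)
      also have "\<dots> \<le> c / 2 * real n" by (rule M)
      finally show ?case using elim by linarith
    qed
  qed
qed

lemma AE_sum_digits_small:
  "AE x in inv_measure. (\<lambda>n. (\<Sum>k<n. real_of_int (digit ((T ^^ k) x))) / (real n * b n)) \<longlonglongrightarrow> 0"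
proof -
  have "AE x in inv_measure. \<forall>i. \<forall>\<^sub>F n in sequentially.
      \<alpha> (\<Sum>k<n. real_of_int (digit ((T ^^ k) x))) < 1 / real (Suc i) * real n"
    by (subst AE_all_countable) (intro allI AE_alpha_sum_small, simp)
  moreover have "AE x in inv_measure. x \<in> {0..\<theta>}" by (simp add: AE_inv_measure_iff)
  ultimately show ?thesis
  proof eventually_elim
    case (elim x)
    define S where "S n = (\<Sum>k<n. real_of_int (digit ((T ^^ k) x)))" for n
    have S: "0 \<le> S n" for n
      unfolding S_def using elim(2) T_funpow_range[of x] by (intro sum_nonneg) (simp add: digit_nonneg)
    show ?case unfolding S_def[symmetric]
    proof (rule LIMSEQ_I)
      fix e :: real assume "0 < e"
      then obtain i where i: "1 / real (Suc i) < e" using nat_approx_posE by blast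
      have "\<forall>\<^sub>F n in sequentially. \<alpha> (S n) < 1 / real (Suc i) * real n"
        using elim(1) unfolding S_def by blast
      moreover have "\<forall>\<^sub>F n in sequentially. 0 < n" by (rule eventually_gt_at_top)
      ultimately have "\<forall>\<^sub>F n in sequentially. norm (S n / (real n * b n) - 0) < e"
      proof eventually_elim
        case (elim n)
        \<comment> \<open>The index \<open>k\<close> lies below \<open>n / (i + 1)\<close> and hence
          is at most \<open>n\<close>, so monotonicity of \<open>b\<close> replaces
          \<open>b k\<close> by \<open>b n\<close>.\<close>
        then obtain k where k: "real k < 1 / real (Suc i) * real n" "S n < 1 / real (Suc i) * real n * b k"
          by (auto elim: alpha_lessD)
        have "1 / real (Suc i) * real n \<le> 1 * real n" by (intro mult_right_mono) auto
        hence "k \<le> n" using k(1) by simp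
        hence "b k \<le> b n" using b_mono by (simp add: incseqD)
        hence "1 / real (Suc i) * real n * b k \<le> 1 / real (Suc i) * real n * b n" by (intro mult_left_mono) auto
        also have "\<dots> \<le> e * real n * b n" using i b_pos[of n] by (intro mult_right_mono) auto
        finally have "S n < e * (real n * b n)" using k(2) by (simp add: mult.assoc)
        thus ?case using S[of n] b_pos[of n] elim(2) by (simp add: pos_divide_less_eq)
      qed
      thus "\<exists>no. \<forall>n\<ge>no. norm (S n / (real n * b n) - 0) < e"
        by (simp add: eventually_sequentially)
    qed
  qed
qed

end

section \<open>The dichotomy\<close>

context theta_map
begin

lemma S_theta_eq: "S_theta \<theta> n x = (\<Sum>k<n. real_of_int (digit ((T ^^ k) x)))"
  unfolding S_theta_def digit_theta_def digit_def
  by (rule sum.reindex_bij_witness[of _ Suc "\<lambda>k. k - 1"]) auto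

lemma AE_gamma_theta:
  assumes "AE x in inv_measure. P x"
  shows "AE x in gamma_theta \<theta>. P x"
proof -
  have "AE x in restrict_space lborel {0..\<theta>}. P x"
    using assms by (subst AE_restrict_space_iff) (auto simp: AE_inv_measure_iff)
  moreover have "(\<lambda>x. ennreal (\<theta> / (ln (1 + \<theta>\<^sup>2) * (1 + \<theta> * x)))) \<in> borel_measurable (restrict_space lborel {0..\<theta>})"
    by (intro measurable_restrict_space1) measurable
  ultimately show ?thesis
    unfolding gamma_theta_def by (subst AE_density) auto
qed

text \<open>The bound \<open>N\<close> is arbitrary, so that intersecting over all \<open>N\<close>
  yields infinitely many large digits.\<close>

lemma AE_large_digits:
  fixes a :: "nat \<Rightarrow> real" and N :: nat
  assumes a_ge: "\<And>k. a 0 \<le> a k" "0 < a 0" and div: "\<not> summable (\<lambda>k. 1 / a k)" and K: "0 < K"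
  shows "AE x in inv_measure. \<exists>k\<ge>N. K * a k < real_of_int (digit ((T ^^ k) x))"
proof -
  have a: "0 < a k" for k using a_ge(1)[of k] a_ge(2) by linarith
  \<comment> \<open>Chosen so that \<open>s = q / a k\<close> and \<open>t = K * a k\<close> meet
    the conditions of \<open>avoidance_small_digits\<close> for all \<open>k\<close> at once; since
    \<open>a 0 \<le> a k\<close>, only \<open>a 0\<close> has to appear.\<close>
  define q where "q = min (\<theta> * a 0) (1 / (\<theta> * (K + 1 / a 0)))"
  define C where "C = exp (- 2 * distortion * \<theta>) / \<theta>"
  \<comment> \<open>The first \<open>N\<close> digits are unrestricted, with \<open>c k = 0\<close>.
    Changing finitely many terms keeps the series divergent and forces the digit that leaves
    \<open>W k\<close> to have \<open>k \<ge> N\<close>.\<close>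
  define W where "W k = (if k < N then UNIV else {d. real_of_int d \<le> K * a k})" for k
  define c where "c k = (if k < N then 0 else C * (q / a k))" for k
  have K0: "0 < K + 1 / a 0" using a K by (simp add: add_pos_pos)
  have q: "0 < q" using theta_pos a K0 by (simp add: q_def)
  have C: "0 < C" using theta_pos by (simp add: C_def)
  have q_le: "q / a k \<le> \<theta>" for k
  proof -
    have "q \<le> \<theta> * a 0" by (simp add: q_def)
    also have "\<dots> \<le> \<theta> * a k" using a_ge theta_pos by simp
    finally show ?thesis using a[of k] by (simp add: pos_divide_le_eq)
  qed
  have q_le': "q / a k * (\<theta> * (K * a k + 1)) \<le> 1" for k
  proof -
    have "q / a k * (\<theta> * (K * a k + 1)) = q * (\<theta> * (K + 1 / a k))"
      using a[of k] by (simp add: field_simps)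
    also have "\<dots> \<le> q * (\<theta> * (K + 1 / a 0))"
      using q theta_pos a_ge a by (intro mult_left_mono add_left_mono divide_left_mono) auto
    also have "\<dots> \<le> 1 / (\<theta> * (K + 1 / a 0)) * (\<theta> * (K + 1 / a 0))"
      using theta_pos K0 by (intro mult_right_mono) (auto simp: q_def)
    also have "\<dots> = 1" using theta_pos K0 by simp
    finally show ?thesis .
  qed
  have avoid: "avoidance (W k) (c k)" for k
    using avoidance_small_digits[of "q / a k" "K * a k"] q a[of k] K q_le[of k] q_le'[of k]
    by (auto simp: W_def c_def C_def avoidance_UNIV)
  have c_nonneg: "0 \<le> c k" for k using C q a[of k] by (simp add: c_def)
  have c_le: "c k \<le> 1" for k
  proof -
    have "C * (q / a k) \<le> C * \<theta>" using C q_le by (intro mult_left_mono) auto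
    also have "\<dots> \<le> 1" using theta_pos distortion_nonneg by (simp add: C_def)
    finally show ?thesis by (simp add: c_def)
  qed
  have c_div: "\<not> summable c"
  proof
    assume "summable c"
    moreover have "\<forall>\<^sub>F k in sequentially. c k = C * q * (1 / a k)"
      using eventually_ge_at_top[of N] by eventually_elim (simp add: c_def)
    ultimately have "summable (\<lambda>k. C * q * (1 / a k))"
      by (simp cong: summable_cong)
    thus False using div C q summable_mult_D[of "C * q" "\<lambda>k. 1 / a k"] by simp
  qed
  have "AE x in lborel. x \<in> {0..\<theta>} \<longrightarrow> (\<exists>k. digit ((T ^^ k) x) \<notin> W k)"
    by (rule AE_digit_leaves[OF avoid c_nonneg c_le c_div])
  hence "AE x in inv_measure. \<exists>k. digit ((T ^^ k) x) \<notin> W k"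
    by (simp only: AE_inv_measure_iff)
  thus ?thesis
  proof eventually_elim
    case (elim x)
    then obtain k where k: "digit ((T ^^ k) x) \<notin> W k" by blast
    hence "N \<le> k" "K * a k < real_of_int (digit ((T ^^ k) x))"
      by (auto simp: W_def not_less[symmetric] split: if_splits)
    thus ?case by blast
  qed
qed

lemma AE_limsup_infinite:
  fixes a :: "nat \<Rightarrow> real"
  assumes a_ge: "\<And>k. a 0 \<le> a k" "0 < a 0" and div: "\<not> summable (\<lambda>k. 1 / a k)"
  shows "AE x in inv_measure. limsup (\<lambda>n. ereal (S_theta \<theta> (Suc n) x / a n)) = \<infinity>"
proof -
  \<comment> \<open>Countably many factors suffice; \<open>Suc K\<close> keeps the factor
    positive.\<close>
  have "AE x in inv_measure. \<forall>K N. \<exists>k\<ge>N. real (Suc K) * a k < real_of_int (digit ((T ^^ k) x))"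
    unfolding AE_all_countable by (intro allI AE_large_digits assms) simp
  moreover have "AE x in inv_measure. x \<in> {0..\<theta>}" by (simp add: AE_inv_measure_iff)
  ultimately show ?thesis
  proof eventually_elim
    case (elim x)
    show ?case
    proof (rule ccontr)
      assume "limsup (\<lambda>n. ereal (S_theta \<theta> (Suc n) x / a n)) \<noteq> \<infinity>"
      then obtain K :: nat where "limsup (\<lambda>n. ereal (S_theta \<theta> (Suc n) x / a n)) < ereal (real K)"
        using less_PInf_Ex_of_nat by auto
      hence "\<forall>\<^sub>F n in sequentially. ereal (S_theta \<theta> (Suc n) x / a n) < ereal (real K)"
        by (rule Limsup_lessD)
      then obtain N where N: "\<And>n. N \<le> n \<Longrightarrow> S_theta \<theta> (Suc n) x / a n < real K"
        unfolding eventually_sequentially by auto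
      obtain k where k: "N \<le> k" "real (Suc K) * a k < real_of_int (digit ((T ^^ k) x))"
        using elim(1) by blast
      have a: "0 < a k" using a_ge(1)[of k] a_ge(2) by linarith
      have "real K * a k \<le> real (Suc K) * a k" using a by (intro mult_right_mono) auto
      also note k(2)
      also have "real_of_int (digit ((T ^^ k) x)) \<le> S_theta \<theta> (Suc k) x"
        using elim(2) T_funpow_range[of x] unfolding S_theta_eq
        by (intro member_le_sum) (auto simp: digit_nonneg)
      finally show False using N[OF k(1)] a by (simp add: pos_divide_less_eq)
    qed
  qed
qed

end

theorem theorem1p7:
  fixes \<theta> :: real and m :: nat and a :: "nat \<Rightarrow> real"
  assumes "0 < \<theta>" "\<theta> < 1" "\<theta> \<notin> \<rat>"
    and "m > 0" "\<theta>\<^sup>2 = 1 / real m"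
    and "\<And>n. n \<ge> 1 \<Longrightarrow> a n > 0"
    and "\<And>n. n \<ge> 1 \<Longrightarrow> a n / real n \<le> a (Suc n) / real (Suc n)"
  shows "AE x in gamma_theta \<theta>.
           (summable (\<lambda>n. 1 / a (Suc n)) \<longrightarrow>
              (\<lambda>n. S_theta \<theta> (Suc n) x / a (Suc n)) \<longlonglongrightarrow> 0) \<and>
           (\<not> summable (\<lambda>n. 1 / a (Suc n)) \<longrightarrow>
              limsup (\<lambda>n. ereal (S_theta \<theta> (Suc n) x / a (Suc n))) = \<infinity>)"
proof -
  interpret theta_map \<theta> m by unfold_locales fact+
  \<comment> \<open>Nothing is assumed about \<open>a 0\<close>. Repeating the value
    \<open>b 1 = a 1\<close> at \<open>0\<close> keeps \<open>b\<close> positive and nondecreasing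
    from the start.\<close>
  define b where "b n = (if n = 0 then a 1 else a n / real n)" for n
  have a_eq: "a (Suc n) = real (Suc n) * b (Suc n)" for n by (simp add: b_def)
  interpret slow_scale b
  proof
    show "0 < b n" for n using assms(6) by (simp add: b_def)
    show "incseq b" using assms(7) by (intro incseq_SucI) (simp add: b_def del: of_nat_Suc)
  qed
  show ?thesis
  proof (cases "summable (\<lambda>n. 1 / a (Suc n))")
    case True
    interpret summable_theta \<theta> m b
      by unfold_locales (use True in \<open>simp only: a_eq\<close>)
    have "AE x in inv_measure. (\<lambda>n. S_theta \<theta> (Suc n) x / a (Suc n)) \<longlonglongrightarrow> 0"
      using AE_sum_digits_small
    proof eventually_elim
      case (elim x)
      thus ?case unfolding S_theta_eq a_eq by (rule LIMSEQ_Suc)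
    qed
    thus ?thesis using True by (auto dest: AE_gamma_theta)
  next
    case False
    have "a (Suc 0) \<le> a (Suc k)" for k
    proof -
      have "1 * b 1 \<le> real (Suc k) * b (Suc k)"
        using b_pos[of 1] b_mono by (intro mult_mono) (auto simp: incseqD)
      thus ?thesis using a_eq[of 0] a_eq[of k] by simp
    qed
    hence "AE x in inv_measure. limsup (\<lambda>n. ereal (S_theta \<theta> (Suc n) x / a (Suc n))) = \<infinity>"
      using AE_limsup_infinite[of "\<lambda>n. a (Suc n)"] assms(6)[of 1] False by simp
    thus ?thesis using False by (auto dest: AE_gamma_theta)
  qed
qed

end
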